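(* Let $A,B\in\mathbb{R}^{n\times n}$ be (symmetric) positive definite matrices and let $q\ge 1$. Then $$\sum_{i=1}^n\big|\log\lambda_i(A)-\log\lambda_i(B)\big|^q\le d_q^q(A,B)\le \sum_{i=1}^n\big|\log\lambda_i(A)-\log\lambda_{n-i+1}(B)\big|^q.$$
   Context: For a real symmetric $n\times n$ matrix $X$, $\lambda_1(X)\ge\cdots\ge\lambda_n(X)$ denote its eigenvalues in descending order (with multiplicity). For positive definite $A,B$ and $q\ge1$, $d_q(A,B)=\big\|\mathrm{Log}\big(B^{-1/2}AB^{-1/2}\big)\big\|_q$, and $d_q^q(A,B)=(d_q(A,B))^q$. Here $\mathrm{Log}$ is the (principal, symmetric) matrix logarithm of a positive definite matrix, $B^{-1/2}$ is the inverse of the positive definite square root of $B$, and $\|Z\|_q=\big(\sum_{i=1}^n\sigma_i(Z)^q\big)^{1/q}$ is the Schatten-$q$ norm of $Z\in\mathbb{R}^{n\times n}$, where $\sigma_i(Z)$ are the singular values of $Z$. *)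

theory Defs
  imports
    "HOL-Analysis.Analysis"
    "HOL-Computational_Algebra.Polynomial"
begin

definition charpoly :: "real^'n^'n \<Rightarrow> real poly" where
  "charpoly A = det (\<chi> i j. (if i = j then [:0, 1:] else 0) - [:A $ i $ j:])"

(* eig i A is the i-th largest eigenvalue, 1 <= i <= CARD('n), counted with multiplicity.
   Only the real roots of the characteristic polynomial are listed, so for i up to CARD('n) it is
   meaningful for matrices all of whose eigenvalues are real, in particular symmetric ones. *)
definition eig :: "nat \<Rightarrow> real^'n^'n \<Rightarrow> real" where
  "eig i A = rev (sorted_list_of_multiset (proots (charpoly A))) ! (i - 1)"

definition sing_val :: "nat \<Rightarrow> real^'n^'n \<Rightarrow> real" where
  "sing_val i Z = sqrt (eig i (transpose Z ** Z))"

definition schatten_norm :: "real \<Rightarrow> real^'n^'n \<Rightarrow> real" where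
  "schatten_norm q Z = (\<Sum>i = 1..CARD('n). sing_val i Z powr q) powr (1 / q)"

definition sym_mat :: "real^'n^'n \<Rightarrow> bool" where
  "sym_mat A \<longleftrightarrow> transpose A = A"

definition pos_def :: "real^'n^'n \<Rightarrow> bool" where
  "pos_def A \<longleftrightarrow> sym_mat A \<and> (\<forall>x. x \<noteq> 0 \<longrightarrow> x \<bullet> (A *v x) > 0)"

(* The powers X^k are iterated products: the type real^'n^'n carries a componentwise
   multiplication, so the operator ^ would not denote the matrix power. *)
definition mat_exp :: "real^'n^'n \<Rightarrow> real^'n^'n" where
  "mat_exp X = (\<Sum>k. (1 / fact k) *\<^sub>R (((**) X) ^^ k) (mat 1))"

(* A positive definite matrix has exactly one symmetric logarithm and exactly one positive
   definite square root; on other arguments the next two functions are unspecified. *)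
definition mat_log :: "real^'n^'n \<Rightarrow> real^'n^'n" where
  "mat_log A = (THE X. sym_mat X \<and> mat_exp X = A)"

definition mat_sqrt :: "real^'n^'n \<Rightarrow> real^'n^'n" where
  "mat_sqrt A = (THE S. pos_def S \<and> S ** S = A)"

definition spd_dist :: "real \<Rightarrow> real^'n^'n \<Rightarrow> real^'n^'n \<Rightarrow> real" where
  "spd_dist q A B =
     (let R = matrix_inv (mat_sqrt B) in schatten_norm q (mat_log (R ** A ** R)))"

end

theory Submission
  imports Defs
begin

text \<open>
  Put \<open>C = B\<^sup>-\<^sup>1\<^sup>/\<^sup>2 A B\<^sup>-\<^sup>1\<^sup>/\<^sup>2\<close>, so that \<open>d\<^sub>q\<^sup>q(A,B) = \<Sum>\<^sub>i |log \<lambda>\<^sub>i(C)|\<^sup>q\<close>. For symmetric invertible \<open>S\<close>, positive definite \<open>N\<close>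
  and every index set \<open>I\<close>, the multiplicative Lidskii inequality bounds the product over \<open>I\<close> of
  \<open>\<lambda>\<^sub>i(S N S) / \<lambda>\<^sub>i(S\<^sup>2)\<close> by the product of the \<open>|I|\<close> largest eigenvalues of \<open>N\<close>. Applied to
  \<open>A = B\<^sup>1\<^sup>/\<^sup>2 C B\<^sup>1\<^sup>/\<^sup>2\<close> it shows that \<open>log \<lambda>(A) - log \<lambda>(B)\<close> is majorized by \<open>log \<lambda>(C)\<close>; applied to
  \<open>C = B\<^sup>-\<^sup>1\<^sup>/\<^sup>2 A B\<^sup>-\<^sup>1\<^sup>/\<^sup>2\<close> it shows that \<open>log \<lambda>(C)\<close> is majorized by \<open>log \<lambda>\<down>(A) - log \<lambda>\<up>(B)\<close>.
  Karamata's inequality for the convex function \<open>|t|\<^sup>q\<close> turns the two majorizations into the claim.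
\<close>

section \<open>The spectral theorem\<close>

lemma sym_mat_inner:
  assumes "sym_mat A"
  shows "x \<bullet> (A *v y) = (A *v x) \<bullet> y"
  using assms by (metis dot_lmul_matrix sym_mat_def transpose_matrix_vector)

text \<open>A maximizer \<open>v\<close> of the quadratic form on the unit sphere of
  \<open>V\<close> is an eigenvector: if the residual \<open>w = c v - A v\<close> were nonzero, a
  small move from \<open>v\<close> in direction \<open>- w\<close> would violate maximality.\<close>

lemma sym_mat_eigenvector_exists:
  assumes A: "sym_mat A" and V: "subspace V" "\<And>x. x \<in> V \<Longrightarrow> A *v x \<in> V"
    and y: "y \<in> V" "y \<noteq> 0"
  obtains v c where "v \<in> V" "norm v = 1" "A *v v = c *\<^sub>R v"
proof -
  let ?S = "V \<inter> sphere 0 1" and ?f = "\<lambda>x. x \<bullet> (A *v x)"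
  have "compact ?S"
    using closed_subspace[OF V(1)] compact_sphere by (metis closed_Int_compact)
  moreover have "(1 / norm y) *\<^sub>R y \<in> ?S"
    using y V(1) by (auto simp: subspace_scale)
  moreover have "continuous_on ?S ?f"
    by (intro continuous_intros linear_continuous_on matrix_vector_mul_bounded_linear)
  ultimately obtain v where v: "v \<in> ?S" and vmax: "\<And>x. x \<in> ?S \<Longrightarrow> ?f x \<le> ?f v"
    using continuous_attains_sup[of ?S ?f] by blast
  define c where "c = ?f v"
  have le: "?f x \<le> c * (x \<bullet> x)" if "x \<in> V" for x
  proof (cases "x = 0")
    case False
    let ?u = "(1 / norm x) *\<^sub>R x"
    have "?f x / (x \<bullet> x) = ?f ?u"
      using False
      by (simp add: linear_scale[OF matrix_vector_mul_linear] dot_square_norm power2_eq_square)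
    also have "\<dots> \<le> c"
      unfolding c_def using False that V(1) by (intro vmax) (auto simp: subspace_scale)
    finally show ?thesis
      using False by (simp add: pos_divide_le_eq)
  qed auto
  define w where "w = c *\<^sub>R v - A *v v"
  have wV: "w \<in> V"
    using v V unfolding w_def by (auto intro!: subspace_diff subspace_scale)
  define k where "k = c * (w \<bullet> w) - ?f w"
  have vv: "v \<bullet> v = 1" using v by (simp add: dot_square_norm)
  \<comment> \<open>The right-hand side is \<open>c * (x \<bullet> x) - ?f x\<close> at
    \<open>x = v + t *\<^sub>R w\<close>; the constant terms and those with
    \<open>w \<bullet> v\<close> cancel.\<close>
  have quad: "0 \<le> 2 * t * (w \<bullet> w) + t\<^sup>2 * k" for t
  proof -
    have "v + t *\<^sub>R w \<in> V"
      using v wV V(1) by (auto intro!: subspace_add subspace_scale)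
    note le[OF this]
    moreover have "?f (v + t *\<^sub>R w) = c + 2 * t * (w \<bullet> (A *v v)) + t\<^sup>2 * ?f w"
      using sym_mat_inner[OF A, of v w]
      by (simp add: matrix_vector_right_distrib matrix_vector_mult_scaleR inner_add_left
          inner_add_right inner_commute c_def power2_eq_square algebra_simps)
    moreover have "(v + t *\<^sub>R w) \<bullet> (v + t *\<^sub>R w) = 1 + 2 * t * (w \<bullet> v) + t\<^sup>2 * (w \<bullet> w)"
      using vv by (simp add: inner_add_left inner_add_right inner_commute power2_eq_square algebra_simps)
    moreover have "w \<bullet> (A *v v) = c * (w \<bullet> v) - w \<bullet> w"
      unfolding w_def by (simp add: inner_diff_right)
    ultimately have "c + 2 * t * (c * (w \<bullet> v) - w \<bullet> w) + t\<^sup>2 * ?f w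
        \<le> c * (1 + 2 * t * (w \<bullet> v) + t\<^sup>2 * (w \<bullet> w))"
      by metis
    then show ?thesis
      unfolding k_def by (simp add: algebra_simps)
  qed
  have "w \<bullet> w = 0"
  proof (rule ccontr)
    assume "w \<bullet> w \<noteq> 0"
    then have pos: "w \<bullet> w > 0" using inner_ge_zero[of w] by linarith
    \<comment> \<open>A negative \<open>t\<close> with
      \<open>\<bar>t * k\<bar> \<le> w \<bullet> w\<close>, so that the linear term wins in
      \<open>quad\<close>; the \<open>+ 1\<close> keeps the denominator positive.\<close>
    define t where "t = - (w \<bullet> w) / (\<bar>k\<bar> + 1)"
    have "t < 0" using pos unfolding t_def by (simp add: divide_neg_pos)
    have "k / (\<bar>k\<bar> + 1) \<le> 1" by (simp add: pos_divide_le_eq)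
    from mult_left_mono[OF this, of "w \<bullet> w"] pos have "- t * k \<le> w \<bullet> w"
      unfolding t_def by simp
    then have "2 * (w \<bullet> w) + t * k > 0" using pos by linarith
    then have "t * (2 * (w \<bullet> w) + t * k) < 0" using \<open>t < 0\<close> by (simp add: mult_neg_pos)
    with quad[of t] show False by (simp add: power2_eq_square algebra_simps)
  qed
  then have "A *v v = c *\<^sub>R v" unfolding w_def by simp
  with v show thesis using that by auto
qed

text \<open>By symmetry the orthogonal complement of a set of eigenvectors is invariant under
  \<open>A\<close>. It is nonzero while fewer than \<open>CARD('n)\<close> vectors have been found,
  so it supplies the next one.\<close>

lemma sym_mat_orthonormal_eigenvectors:
  fixes A :: "real^'n^'n"
  assumes A: "sym_mat A" and "k \<le> CARD('n)"
  shows "\<exists>B. finite B \<and> card B = k \<and> pairwise orthogonal B \<and>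
           (\<forall>v\<in>B. norm v = 1 \<and> (\<exists>c. A *v v = c *\<^sub>R v))"
  using assms(2)
proof (induction k)
  case 0
  show ?case by (intro exI[of _ "{}"]) auto
next
  case (Suc k)
  then obtain B where B: "finite B" "card B = k" "pairwise orthogonal B"
    "\<And>v. v \<in> B \<Longrightarrow> norm v = 1" "\<And>v. v \<in> B \<Longrightarrow> \<exists>c. A *v v = c *\<^sub>R v"
    by auto
  define V where "V = {x. \<forall>v\<in>B. orthogonal v x}"
  have V: "subspace V" unfolding V_def subspace_def
    by (auto simp: orthogonal_clauses orthogonal_def inner_add_right)
  have inv: "A *v x \<in> V" if "x \<in> V" for x
  proof -
    have "orthogonal v (A *v x)" if "v \<in> B" for v
    proof -
      from B(5)[OF that] obtain c where "A *v v = c *\<^sub>R v" by blast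
      then show ?thesis
        using \<open>x \<in> V\<close> that unfolding orthogonal_def V_def sym_mat_inner[OF A] by simp
    qed
    then show ?thesis unfolding V_def by simp
  qed
  have "dim B < DIM(real^'n)"
    using dim_le_card[OF span_superset B(1)] B(2) Suc.prems by simp
  then obtain y where y: "y \<noteq> 0" "\<And>x. x \<in> span B \<Longrightarrow> orthogonal y x"
    using orthogonal_to_subspace_exists by blast
  then have "y \<in> V" unfolding V_def by (auto simp: span_base orthogonal_commute)
  then obtain v c where v: "v \<in> V" "norm v = 1" "A *v v = c *\<^sub>R v"
    using sym_mat_eigenvector_exists[OF A V inv _ y(1)] by metis
  have "v \<notin> B" using v unfolding V_def by (force simp: orthogonal_def dot_square_norm)
  moreover have "pairwise orthogonal (insert v B)"
    using v(1) B(3) unfolding V_def pairwise_insert by (auto simp: orthogonal_commute)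
  ultimately show ?case
    using B v by (intro exI[of _ "insert v B"]) auto
qed

section \<open>Orthogonally diagonalized matrices and their calculus\<close>

definition diag_mat :: "('n \<Rightarrow> real) \<Rightarrow> real^'n^'n" where
  "diag_mat d = (\<chi> i j. if i = j then d i else 0)"

text \<open>For orthogonal \<open>U\<close>, the symmetric matrix with eigenvector
  \<open>column j U\<close> for the eigenvalue \<open>d j\<close>. Products and matrix functions
  then act on \<open>d\<close> alone; the index type \<open>'n\<close> leaves the eigenvalues
  unordered.\<close>

definition spec_mat :: "real^'n^'n \<Rightarrow> ('n \<Rightarrow> real) \<Rightarrow> real^'n^'n" where
  "spec_mat U d = U ** diag_mat d ** transpose U"

lemma mult_diag_mat_nth: "(M ** diag_mat d) $ i $ j = M $ i $ j * d j"
  by (simp add: matrix_matrix_mult_def diag_mat_def if_distrib cong: if_cong)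

lemma diag_mat_mult_nth: "(diag_mat d ** M) $ i $ j = d i * M $ i $ j"
  by (simp add: matrix_matrix_mult_def diag_mat_def if_distrib if_distribR cong: if_cong)

lemma diag_mat_mult: "diag_mat d ** diag_mat e = diag_mat (\<lambda>i. d i * e i)"
  by (simp add: vec_eq_iff mult_diag_mat_nth) (simp add: diag_mat_def)

lemma diag_mat_const: "diag_mat (\<lambda>_. c) = mat c"
  by (simp add: vec_eq_iff diag_mat_def mat_def)

lemma diag_mat_vector_nth: "(diag_mat d *v y) $ i = d i * y $ i"
  by (simp add: matrix_vector_mult_def diag_mat_def if_distrib if_distribR cong: if_cong)

lemma transpose_diag_mat [simp]: "transpose (diag_mat d) = diag_mat d"
  by (simp add: vec_eq_iff diag_mat_def transpose_def)

lemma transpose_spec_mat [simp]: "transpose (spec_mat U d) = spec_mat U d"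
  by (simp add: spec_mat_def matrix_transpose_mul matrix_mul_assoc)

lemma sym_spec_mat [simp]: "sym_mat (spec_mat U d)"
  by (simp add: sym_mat_def)

lemma spec_mat_mult:
  assumes "orthogonal_matrix U"
  shows "spec_mat U d ** spec_mat U e = spec_mat U (\<lambda>i. d i * e i)"
proof -
  have "spec_mat U d ** spec_mat U e = U ** diag_mat d ** (transpose U ** U) ** diag_mat e ** transpose U"
    by (simp add: spec_mat_def matrix_mul_assoc)
  also have "\<dots> = U ** (diag_mat d ** diag_mat e) ** transpose U"
    using assms by (simp add: orthogonal_matrix_def matrix_mul_assoc)
  finally show ?thesis by (simp add: diag_mat_mult spec_mat_def)
qed

lemma spec_mat_const_1:
  assumes "orthogonal_matrix U"
  shows "spec_mat U (\<lambda>_. 1) = mat 1"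
  using assms by (simp add: spec_mat_def diag_mat_const orthogonal_matrix_def)

lemma det_spec_mat:
  assumes "orthogonal_matrix U"
  shows "det (spec_mat U d) = (\<Prod>j\<in>UNIV. d j)"
proof -
  have "det U * det U = 1"
    using assms by (metis det_I det_mul det_transpose orthogonal_matrix_def)
  moreover have "det (diag_mat d) = (\<Prod>j\<in>UNIV. d j)"
    by (subst det_diagonal) (auto simp: diag_mat_def)
  ultimately show ?thesis
    by (simp add: spec_mat_def det_mul)
qed

text \<open>In the coordinates given by the columns of \<open>U\<close> the form is a weighted sum
  of squares, so forms sharing \<open>U\<close> are compared coefficient by coefficient.\<close>

lemma inner_spec_mat:
  fixes x :: "real^'n"
  shows
  "x \<bullet> (spec_mat U d *v x) = (\<Sum>j\<in>UNIV. d j * (column j U \<bullet> x)\<^sup>2)"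
proof -
  let ?y = "transpose U *v x"
  have "spec_mat U d *v x = U *v (diag_mat d *v ?y)"
    by (simp add: spec_mat_def matrix_vector_mul_assoc matrix_mul_assoc del: transpose_matrix_vector)
  then have "x \<bullet> (spec_mat U d *v x) = ?y \<bullet> (diag_mat d *v ?y)"
    by (simp add: dot_lmul_matrix[symmetric])
  also have "\<dots> = (\<Sum>j\<in>UNIV. d j * (?y $ j)\<^sup>2)"
    by (simp add: inner_vec_def diag_mat_vector_nth power2_eq_square mult_ac)
  also have "\<dots> = (\<Sum>j\<in>UNIV. d j * (column j U \<bullet> x)\<^sup>2)"
    unfolding matrix_vector_mul_component by (simp add: transpose_def column_def)
  finally show ?thesis .
qed

lemma inner_orthogonal_columns:
  fixes x :: "real^'n"
  assumes "orthogonal_matrix U"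
  shows "x \<bullet> x = (\<Sum>j\<in>UNIV. (column j U \<bullet> x)\<^sup>2)"
  using inner_spec_mat[of x U "\<lambda>_. 1"] spec_mat_const_1[OF assms] by simp

lemma inner_spec_mat_column:
  assumes "orthogonal_matrix U"
  shows "column i U \<bullet> (spec_mat U d *v column i U) = d i"
proof -
  have "column j U \<bullet> column i U = (if j = i then 1 else 0)" for j
    using assms unfolding orthogonal_matrix_orthonormal_columns
    by (auto simp: orthogonal_def dot_square_norm)
  then have "d j * (column j U \<bullet> column i U)\<^sup>2 = (if j = i then d i else 0)" for j
    by simp
  then show ?thesis
    unfolding inner_spec_mat by simp
qed

lemma pos_def_spec_mat_iff:
  assumes "orthogonal_matrix U"
  shows "pos_def (spec_mat U d) \<longleftrightarrow> (\<forall>i. d i > 0)"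
proof
  assume pd: "pos_def (spec_mat U d)"
  show "\<forall>i. d i > 0"
  proof
    fix i
    have "norm (column i U) = 1"
      using assms unfolding orthogonal_matrix_orthonormal_columns by simp
    then have "column i U \<noteq> 0" by auto
    with pd inner_spec_mat_column[OF assms, of i d] show "d i > 0"
      unfolding pos_def_def by metis
  qed
next
  assume d: "\<forall>i. d i > 0"
  have "x \<bullet> (spec_mat U d *v x) > 0" if "x \<noteq> 0" for x
  proof -
    have "(\<Sum>j\<in>UNIV. (column j U \<bullet> x)\<^sup>2) \<noteq> 0"
      using that inner_orthogonal_columns[OF assms, of x] by (metis inner_eq_zero_iff)
    then obtain j where "(column j U \<bullet> x)\<^sup>2 \<noteq> 0" by (meson sum.neutral)
    then show ?thesis
      unfolding inner_spec_mat using d by (intro sum_pos2[of _ j]) (auto simp: less_imp_le)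
  qed
  then show "pos_def (spec_mat U d)" by (simp add: pos_def_def)
qed

text \<open>Orthonormal eigenvectors form the columns of \<open>U\<close>, which gives
  \<open>A ** U = U ** diag_mat d\<close>; multiplication by \<open>transpose U\<close> on the right
  then isolates \<open>A\<close>.\<close>

theorem sym_mat_spectral:
  fixes A :: "real^'n^'n"
  assumes A: "sym_mat A"
  obtains U d where "orthogonal_matrix U" "A = spec_mat U d"
proof -
  obtain B where B: "finite B" "card B = CARD('n)" "pairwise orthogonal B"
    "\<And>v. v \<in> B \<Longrightarrow> norm v = 1" "\<And>v. v \<in> B \<Longrightarrow> \<exists>c. A *v v = c *\<^sub>R v"
    using sym_mat_orthonormal_eigenvectors[OF A order_refl] by blast
  obtain g where g: "bij_betw g (UNIV :: 'n set) B"
    using finite_same_card_bij[of "UNIV :: 'n set" B] B by auto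
  then have gB: "g j \<in> B" for j by (auto simp: bij_betw_def)
  obtain c where c: "\<And>v. v \<in> B \<Longrightarrow> A *v v = c v *\<^sub>R v"
    using B(5) by metis
  define U :: "real^'n^'n" where "U = (\<chi> i j. g j $ i)"
  define d where "d j = c (g j)" for j
  have col: "column j U = g j" for j
    by (simp add: column_def U_def vec_eq_iff)
  have U: "orthogonal_matrix U"
    unfolding orthogonal_matrix_orthonormal_columns col
    using B(3,4) gB g by (auto simp: pairwise_def bij_betw_def inj_eq)
  have "A ** U = U ** diag_mat d"
  proof (simp add: vec_eq_iff mult_diag_mat_nth, intro allI)
    fix i j
    have "(A ** U) $ i $ j = (A *v g j) $ i"
      by (simp add: matrix_matrix_mult_def matrix_vector_mult_def U_def)
    also have "\<dots> = U $ i $ j * d j"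
      by (simp add: c[OF gB] U_def d_def)
    finally show "(A ** U) $ i $ j = U $ i $ j * d j" .
  qed
  then have "A ** (U ** transpose U) = spec_mat U d"
    by (simp add: spec_mat_def matrix_mul_assoc)
  with U have "A = spec_mat U d" by (simp add: orthogonal_matrix_def)
  with U show thesis using that by blast
qed

text \<open>With \<open>W = V\<^sup>T U\<close> the hypothesis says \<open>e i * W i j = W i j * d j\<close>,
  so \<open>e i = d j\<close> wherever \<open>W i j \<noteq> 0\<close>.\<close>
lemma spec_mat_fun_cong:
  assumes U: "orthogonal_matrix U" and V: "orthogonal_matrix V"
    and eq: "spec_mat U d = spec_mat V e"
  shows "spec_mat U (\<lambda>i. f (d i)) = spec_mat V (\<lambda>i. f (e i))"
proof -
  define W where "W = transpose V ** U"
  have *: "spec_mat U a = spec_mat V b \<longleftrightarrow> W ** diag_mat a = diag_mat b ** W" for a b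
  proof
    assume "spec_mat U a = spec_mat V b"
    then have "transpose V ** spec_mat U a ** U = transpose V ** spec_mat V b ** U" by simp
    then have "W ** diag_mat a ** (transpose U ** U) = (transpose V ** V) ** diag_mat b ** W"
      by (simp add: spec_mat_def W_def matrix_mul_assoc)
    then show "W ** diag_mat a = diag_mat b ** W"
      using U V by (simp add: orthogonal_matrix_def)
  next
    assume "W ** diag_mat a = diag_mat b ** W"
    then have "V ** (W ** diag_mat a) ** transpose U = V ** (diag_mat b ** W) ** transpose U" by simp
    then have "(V ** transpose V) ** U ** diag_mat a ** transpose U
             = V ** diag_mat b ** transpose V ** (U ** transpose U)"
      by (simp add: W_def matrix_mul_assoc)
    then show "spec_mat U a = spec_mat V b"
      using U V by (simp add: orthogonal_matrix_def spec_mat_def)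
  qed
  have "W $ i $ j * f (d j) = f (e i) * W $ i $ j" for i j
  proof (cases "W $ i $ j = 0")
    case False
    have "W $ i $ j * d j = e i * W $ i $ j"
      using eq unfolding * by (metis mult_diag_mat_nth diag_mat_mult_nth)
    then show ?thesis using False by simp
  qed simp
  then show ?thesis
    unfolding * by (simp add: vec_eq_iff mult_diag_mat_nth diag_mat_mult_nth)
qed

section \<open>Eigenvalues in descending order\<close>

text \<open>Reversed sorting by \<open>d\<close>, with positions shifted to start at 1 as in
  \<open>eig\<close>. It serves to order eigenvalues and, in \<open>karamata_subsets\<close>, to
  rearrange a vector.\<close>

lemma antimono_enumeration:
  fixes d :: "'a \<Rightarrow> real"
  assumes "finite J"
  obtains e where "bij_betw e {1..card J} J" "antimono_on {1..card J} (\<lambda>i. d (e i))"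
proof -
  obtain ys where ys: "set ys = J" "distinct ys"
    using finite_distinct_list[OF assms] by blast
  define xs where "xs = rev (sort_key d ys)"
  define e where "e i = xs ! (i - 1)" for i
  have xs: "set xs = J" "distinct xs" "length xs = card J"
    using ys distinct_card[of ys] by (auto simp: xs_def)
  have "bij_betw (\<lambda>i. i - 1) {1..card J} {..<card J}"
    by (rule bij_betw_byWitness[where f' = Suc]) auto
  moreover have "bij_betw ((!) xs) {..<card J} J"
    using xs by (intro bij_betw_nth) auto
  ultimately have "bij_betw e {1..card J} J"
    unfolding e_def by (rule bij_betw_trans[unfolded o_def])
  moreover have "antimono_on {1..card J} (\<lambda>i. d (e i))"
  proof (rule monotone_onI)
    fix i j assume ij: "i \<in> {1..card J}" "j \<in> {1..card J}" "i \<le> j"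
    have "sorted_wrt (\<ge>) (map d xs)"
      unfolding xs_def rev_map[symmetric] sorted_wrt_rev by simp
    then show "d (e i) \<ge> d (e j)"
      using ij xs(3) unfolding e_def sorted_wrt_iff_nth_less
      by (cases "i = j") (auto simp: sorted_wrt_map)
  qed
  ultimately show thesis using that by blast
qed

section \<open>Characteristic polynomial and ordered spectrum of a diagonalized matrix\<close>

lemma spec_mat_nth: "spec_mat U d $ i $ k = (\<Sum>j\<in>UNIV. d j * (U $ i $ j * U $ k $ j))"
  by (simp add: spec_mat_def matrix_matrix_mult_def[of "_ ** _"] mult_diag_mat_nth transpose_def mult_ac)

lemma spec_mat_diff: "spec_mat U (\<lambda>j. d j - e j) = spec_mat U d - spec_mat U e"
  by (simp add: vec_eq_iff spec_mat_nth left_diff_distrib sum_subtractf)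

lemma spec_mat_scaleR: "spec_mat U (\<lambda>j. c * d j) = c *\<^sub>R spec_mat U d"
  by (simp add: vec_eq_iff spec_mat_nth sum_distrib_left mult.assoc)

lemma spec_mat_const:
  assumes "orthogonal_matrix U"
  shows "spec_mat U (\<lambda>_. c) = mat c"
  using spec_mat_scaleR[of U c "\<lambda>_. 1"] spec_mat_const_1[OF assms]
  by (simp add: vec_eq_iff mat_def)

text \<open>Evaluation at \<open>x\<close> is a ring homomorphism, hence commutes with the Leibniz
  expansion of the determinant.\<close>

lemma poly_charpoly: "poly (charpoly A) x = det (mat x - A)"
proof -
  have "poly ((if i = j then [:0, 1:] else 0) - [:A $ i $ j:]) x = (mat x - A) $ i $ j" for i j
    by (simp add: mat_def)
  then show ?thesis
    by (simp add: charpoly_def det_def poly_sum poly_prod del: poly_diff)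
qed

lemma charpoly_spec_mat:
  assumes "orthogonal_matrix U"
  shows "charpoly (spec_mat U d) = (\<Prod>j\<in>UNIV. [:- d j, 1:])"
proof -
  have "poly (charpoly (spec_mat U d)) x = poly (\<Prod>j\<in>UNIV. [:- d j, 1:]) x" for x
    using det_spec_mat[OF assms, of "\<lambda>j. x - d j"]
    by (simp add: poly_charpoly spec_mat_diff spec_mat_const[OF assms] poly_prod)
  then show ?thesis
    by (metis poly_eq_poly_eq_iff ext)
qed

lemma proots_charpoly_spec_mat:
  assumes "orthogonal_matrix U"
  shows "proots (charpoly (spec_mat U d)) = image_mset d (mset_set UNIV)"
proof -
  have "(\<Sum>j\<in>J. {#d j#}) = image_mset d (mset_set J)" if "finite J" for J
    using that by (induction J) auto
  then show ?thesis
    by (simp add: charpoly_spec_mat[OF assms] proots_prod)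
qed

text \<open>A sorted list is determined by its multiset, so every descending enumeration of
  \<open>d\<close> is the list inside \<open>eig\<close>. Later arguments use such enumerations
  instead of lists.\<close>

lemma eig_spec_mat_eqI:
  fixes U :: "real^'n^'n"
  assumes U: "orthogonal_matrix U" and e: "bij_betw e {1..CARD('n)} UNIV"
    and anti: "antimono_on {1..CARD('n)} (\<lambda>i. d (e i))" and i: "i \<in> {1..CARD('n)}"
  shows "eig i (spec_mat U d) = d (e i)"
proof -
  let ?xs = "map (\<lambda>i. d (e i)) [1..<Suc (CARD('n))]"
  have "mset (map e [1..<Suc (CARD('n))]) = image_mset e (mset_set {1..CARD('n)})"
    by (metis atLeastLessThanSuc_atLeastAtMost mset_map mset_upt)
  also have "\<dots> = mset_set UNIV"
    using e by (simp add: bij_betw_def image_mset_mset_set)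
  finally have "image_mset d (mset (map e [1..<Suc (CARD('n))])) = image_mset d (mset_set UNIV)"
    by simp
  then have m: "mset ?xs = image_mset d (mset_set UNIV)"
    unfolding mset_map by (simp add: multiset.map_comp o_def)
  have "sorted_wrt (\<ge>) ?xs"
    unfolding sorted_wrt_iff_nth_less using anti by (auto simp: monotone_on_def simp del: upt_Suc)
  then have "sorted (rev ?xs)" by (simp add: sorted_wrt_rev del: upt_Suc)
  then have "sorted_list_of_multiset (mset (rev ?xs)) = rev ?xs"
    by (simp only: sorted_list_of_multiset_mset sorted_sort_id)
  then have "rev (sorted_list_of_multiset (proots (charpoly (spec_mat U d)))) = ?xs"
    unfolding proots_charpoly_spec_mat[OF U] m[symmetric] mset_rev by simp
  then show ?thesis
    using i by (auto simp: eig_def nth_map_upt simp del: upt_Suc)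
qed

lemma eig_enumeration:
  fixes U :: "real^'n^'n"
  assumes U: "orthogonal_matrix U"
  obtains e where "bij_betw e {1..CARD('n)} UNIV" "antimono_on {1..CARD('n)} (\<lambda>i. d (e i))"
    "\<And>i. i \<in> {1..CARD('n)} \<Longrightarrow> eig i (spec_mat U d) = d (e i)"
  using antimono_enumeration[of "UNIV :: 'n set" d] eig_spec_mat_eqI[OF U] by (metis finite)

lemma eig_antimono:
  fixes A :: "real^'n^'n"
  assumes "sym_mat A" "1 \<le> i" "i \<le> j" "j \<le> CARD('n)"
  shows "eig j A \<le> eig i A"
proof -
  obtain U d where U: "orthogonal_matrix U" "A = spec_mat U d"
    using sym_mat_spectral assms(1) by blast
  obtain e where e: "antimono_on {1..CARD('n)} (\<lambda>i. d (e i))"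
    "\<And>i. i \<in> {1..CARD('n)} \<Longrightarrow> eig i A = d (e i)"
    using eig_enumeration[OF U(1)] unfolding U(2) by metis
  show ?thesis
    using monotone_onD[OF e(1), of i j] e(2) assms by simp
qed

text \<open>A symmetric sum ignores the ordering; this moves log-determinants and Schatten norms
  between \<open>eig\<close> and \<open>d\<close>.\<close>

lemma sum_eig_spec_mat:
  fixes U :: "real^'n^'n"
  assumes U: "orthogonal_matrix U"
  shows "(\<Sum>i = 1..CARD('n). f (eig i (spec_mat U d))) = (\<Sum>j\<in>UNIV. f (d j))"
proof -
  obtain e where e: "bij_betw e {1..CARD('n)} UNIV"
    "\<And>i. i \<in> {1..CARD('n)} \<Longrightarrow> eig i (spec_mat U d) = d (e i)"
    using eig_enumeration[OF U] by metis
  have "(\<Sum>i = 1..CARD('n). f (eig i (spec_mat U d))) = (\<Sum>i = 1..CARD('n). f (d (e i)))"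
    by (intro sum.cong) (auto simp: e(2))
  also have "\<dots> = (\<Sum>j\<in>UNIV. f (d j))"
    by (rule sum.reindex_bij_betw[OF e(1)])
  finally show ?thesis .
qed

lemma eig_pos:
  fixes A :: "real^'n^'n"
  assumes "pos_def A" "i \<in> {1..CARD('n)}"
  shows "eig i A > 0"
proof -
  obtain U d where U: "orthogonal_matrix U" "A = spec_mat U d"
    using sym_mat_spectral assms(1) pos_def_def by metis
  then show ?thesis
    using eig_enumeration[OF U(1), of d] assms pos_def_spec_mat_iff[OF U(1)] by metis
qed

lemma ln_det_pos_def:
  fixes A :: "real^'n^'n"
  assumes "pos_def A"
  shows "ln (det A) = (\<Sum>i = 1..CARD('n). ln (eig i A))"
proof -
  obtain U d where U: "orthogonal_matrix U" "A = spec_mat U d"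
    using sym_mat_spectral assms pos_def_def by metis
  have "d j > 0" for j using assms pos_def_spec_mat_iff[OF U(1)] U(2) by simp
  then show ?thesis
    unfolding U(2) sum_eig_spec_mat[OF U(1)] det_spec_mat[OF U(1)] by (subst ln_prod) (auto, metis less_irrefl)
qed

lemma det_pos_def:
  fixes A :: "real^'n^'n"
  assumes "pos_def A"
  shows "det A > 0"
proof -
  obtain U d where U: "orthogonal_matrix U" "A = spec_mat U d"
    using sym_mat_spectral assms pos_def_def by metis
  then show ?thesis
    using assms pos_def_spec_mat_iff[OF U(1)] by (simp add: det_spec_mat prod_pos)
qed

text \<open>Turns a bound on the \<open>i\<close>-th eigenvalue into a count of entries of
  \<open>d\<close>, the form in which dimension arguments apply.\<close>

lemma eig_ge_iff:
  fixes U :: "real^'n^'n"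
  assumes U: "orthogonal_matrix U" and i: "i \<in> {1..CARD('n)}"
  shows "t \<le> eig i (spec_mat U d) \<longleftrightarrow> i \<le> card {j. t \<le> d j}"
proof -
  let ?A = "spec_mat U d"
  obtain e where e: "bij_betw e {1..CARD('n)} UNIV"
    "\<And>i. i \<in> {1..CARD('n)} \<Longrightarrow> eig i ?A = d (e i)"
    using eig_enumeration[OF U] by metis
  \<comment> \<open>\<open>e\<close> maps \<open>T\<close> bijectively onto the entries reaching
    \<open>t\<close>. By monotonicity \<open>T\<close> contains \<open>{1..i}\<close> if the
    \<open>i\<close>-th eigenvalue reaches \<open>t\<close>, and lies in \<open>{1..<i}\<close>
    otherwise.\<close>
  define T where "T = {m \<in> {1..CARD('n)}. t \<le> eig m ?A}"
  have "{j. t \<le> d j} = e ` T"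
  proof (intro set_eqI iffI)
    fix j assume "j \<in> {j. t \<le> d j}"
    moreover obtain i where "i \<in> {1..CARD('n)}" "e i = j"
      using bij_betw_imp_surj_on[OF e(1)] by (metis UNIV_I imageE)
    ultimately show "j \<in> e ` T" using e(2) by (auto simp: T_def)
  qed (use e(2) in \<open>auto simp: T_def\<close>)
  moreover have "inj_on e T"
    using e(1) unfolding bij_betw_def T_def by (auto intro: inj_on_subset)
  ultimately have card: "card {j. t \<le> d j} = card T" by (simp add: card_image)
  show ?thesis
  proof
    assume t: "t \<le> eig i ?A"
    have "{1..i} \<subseteq> T"
      unfolding T_def using i t eig_antimono[OF sym_spec_mat, of _ i U d] by fastforce
    from card_mono[OF _ this] show "i \<le> card {j. t \<le> d j}" by (simp add: card T_def)
  next
    assume c: "i \<le> card {j. t \<le> d j}"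
    show "t \<le> eig i ?A"
    proof (rule ccontr)
      assume t: "\<not> t \<le> eig i ?A"
      have "T \<subseteq> {1..<i}"
        unfolding T_def using i t eig_antimono[OF sym_spec_mat, of i _ U d]
        by (fastforce simp: not_le[symmetric])
      from card_mono[OF _ this] c i show False by (auto simp: card)
    qed
  qed
qed

text \<open>If the count of eigenvalues above \<open>t\<close> dropped, fewer than \<open>CARD('n)\<close> linear conditions would
  confine \<open>x\<close> to the \<open>\<ge> t\<close> part of \<open>X\<close> and to the \<open>< t\<close> part of \<open>Y\<close>.\<close>
theorem eig_mono:
  fixes X Y :: "real^'n^'n"
  assumes X: "sym_mat X" and Y: "sym_mat Y" and le: "\<And>x. x \<bullet> (X *v x) \<le> x \<bullet> (Y *v x)"
    and i: "i \<in> {1..CARD('n)}"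
  shows "eig i X \<le> eig i Y"
proof -
  obtain U d where U: "orthogonal_matrix U" "X = spec_mat U d"
    using sym_mat_spectral X by blast
  obtain V e where V: "orthogonal_matrix V" "Y = spec_mat V e"
    using sym_mat_spectral Y by blast
  define t where "t = eig i X"
  have "card {j. t \<le> d j} \<le> card {j. t \<le> e j}"
  proof (rule ccontr)
    assume *: "\<not> ?thesis"
    let ?S = "(\<lambda>j. column j U) ` {j. d j < t} \<union> (\<lambda>j. column j V) ` {j. t \<le> e j}"
    have "card {j. d j < t} + card {j. t \<le> d j} = CARD('n)"
      by (subst card_Un_disjoint[symmetric]) (auto intro!: arg_cong[where f = card])
    moreover have "card ?S \<le> card {j. d j < t} + card {j. t \<le> e j}"
      by (intro order_trans[OF card_Un_le] add_mono card_image_le) auto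
    moreover have "dim ?S \<le> card ?S"
      by (intro dim_le_card span_superset) auto
    ultimately have "dim ?S < DIM(real^'n)" using * by simp
    then obtain x where x: "x \<noteq> 0" "\<And>y. y \<in> span ?S \<Longrightarrow> orthogonal x y"
      using orthogonal_to_subspace_exists by blast
    have xU: "column j U \<bullet> x = 0" if "d j < t" for j
      using x(2)[of "column j U"] that by (auto simp: span_base orthogonal_def inner_commute)
    have xV: "column j V \<bullet> x = 0" if "t \<le> e j" for j
      using x(2)[of "column j V"] that by (auto simp: span_base orthogonal_def inner_commute)
    \<comment> \<open>Only columns of \<open>U\<close> with \<open>t \<le> d j\<close> and columns
      of \<open>V\<close> with \<open>e j < t\<close> contribute. The bound for \<open>Y\<close> is
      strict because \<open>x \<noteq> 0\<close>, which contradicts \<open>le\<close>.\<close>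
    have "t * (x \<bullet> x) \<le> x \<bullet> (X *v x)"
      unfolding U(2) inner_spec_mat inner_orthogonal_columns[OF U(1), of x] sum_distrib_left
    proof (rule sum_mono)
      fix j show "t * (column j U \<bullet> x)\<^sup>2 \<le> d j * (column j U \<bullet> x)\<^sup>2"
        using xU[of j] by (cases "d j < t") (auto intro: mult_right_mono)
    qed
    moreover have "x \<bullet> (Y *v x) < t * (x \<bullet> x)"
      unfolding V(2) inner_spec_mat inner_orthogonal_columns[OF V(1), of x] sum_distrib_left
    proof (rule sum_strict_mono_ex1)
      show "\<forall>j\<in>UNIV. e j * (column j V \<bullet> x)\<^sup>2 \<le> t * (column j V \<bullet> x)\<^sup>2"
      proof
        fix j show "e j * (column j V \<bullet> x)\<^sup>2 \<le> t * (column j V \<bullet> x)\<^sup>2"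
          using xV[of j] by (cases "e j < t") (auto intro: mult_right_mono)
      qed
      have "(\<Sum>j\<in>UNIV. (column j V \<bullet> x)\<^sup>2) \<noteq> 0"
        using x(1) inner_orthogonal_columns[OF V(1), of x] by (metis inner_eq_zero_iff)
      then obtain j where j: "(column j V \<bullet> x)\<^sup>2 \<noteq> 0" by (meson sum.neutral)
      with xV[of j] have "e j < t" by force
      with j show "\<exists>j\<in>UNIV. e j * (column j V \<bullet> x)\<^sup>2 < t * (column j V \<bullet> x)\<^sup>2"
        by (intro bexI[of _ j]) auto
    qed simp
    ultimately show False using le[of x] by simp
  qed
  moreover have "i \<le> card {j. t \<le> d j}"
    using eig_ge_iff[OF U(1) i] unfolding t_def U(2) by blast
  ultimately show ?thesis
    using eig_ge_iff[OF V(1) i, of t e] unfolding t_def V(2) by simp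
qed

section \<open>Scaling and inversion of the spectrum\<close>

lemma eig_scaleR:
  fixes A :: "real^'n^'n"
  assumes "sym_mat A" "c \<ge> 0" and i: "i \<in> {1..CARD('n)}"
  shows "eig i (c *\<^sub>R A) = c * eig i A"
proof -
  obtain U d where U: "orthogonal_matrix U" "A = spec_mat U d"
    using sym_mat_spectral assms(1) by blast
  obtain e where e: "bij_betw e {1..CARD('n)} UNIV" "antimono_on {1..CARD('n)} (\<lambda>i. d (e i))"
    "\<And>i. i \<in> {1..CARD('n)} \<Longrightarrow> eig i A = d (e i)"
    using eig_enumeration[OF U(1)] unfolding U(2) by metis
  have "antimono_on {1..CARD('n)} (\<lambda>i. c * d (e i))"
    using e(2) assms(2) by (auto simp: monotone_on_def mult_left_mono)
  from eig_spec_mat_eqI[OF U(1) e(1) this i] show ?thesis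
    by (simp add: U(2)[symmetric] spec_mat_scaleR e(3)[OF i])
qed

text \<open>Inversion reverses the order of positive numbers, so composing a descending enumeration
  of \<open>d\<close> with the reflection \<open>?r\<close> gives one for the inverses.\<close>

lemma eig_spec_mat_inverse:
  fixes U :: "real^'n^'n"
  assumes U: "orthogonal_matrix U" and d: "\<And>j. d j > 0" and i: "i \<in> {1..CARD('n)}"
  shows "eig i (spec_mat U (\<lambda>j. inverse (d j))) = inverse (eig (CARD('n) - i + 1) (spec_mat U d))"
proof -
  obtain e where e: "bij_betw e {1..CARD('n)} UNIV" "antimono_on {1..CARD('n)} (\<lambda>i. d (e i))"
    "\<And>i. i \<in> {1..CARD('n)} \<Longrightarrow> eig i (spec_mat U d) = d (e i)"
    using eig_enumeration[OF U] by metis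
  let ?r = "\<lambda>i. CARD('n) - i + 1"
  have r: "bij_betw ?r {1..CARD('n)} {1..CARD('n)}"
    by (rule bij_betw_byWitness[where f' = ?r]) auto
  have "antimono_on {1..CARD('n)} (\<lambda>i. inverse (d (e (?r i))))"
  proof (rule monotone_onI)
    fix i j assume ij: "i \<in> {1..CARD('n)}" "j \<in> {1..CARD('n)}" "i \<le> j"
    then have "d (e (?r i)) \<le> d (e (?r j))"
      using monotone_onD[OF e(2), of "?r j" "?r i"] by auto
    then show "inverse (d (e (?r i))) \<ge> inverse (d (e (?r j)))"
      using d by (simp add: le_imp_inverse_le)
  qed
  from eig_spec_mat_eqI[OF U bij_betw_trans[OF r e(1), unfolded o_def] this i] e(3)[of "?r i"] i
  show ?thesis by auto
qed

section \<open>Congruence\<close>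

lemma inner_congruence:
  assumes "sym_mat S"
  shows "x \<bullet> ((S ** N ** S) *v x) = (S *v x) \<bullet> (N *v (S *v x))"
  using sym_mat_inner[OF assms, of x "N *v (S *v x)"]
  by (simp add: matrix_vector_mul_assoc matrix_mul_assoc)

lemma sym_congruence:
  assumes "sym_mat S" "sym_mat N"
  shows "sym_mat (S ** N ** S)"
  using assms by (simp add: sym_mat_def matrix_transpose_mul matrix_mul_assoc)

lemma pos_def_congruence:
  fixes S N :: "real^'n^'n"
  assumes S: "sym_mat S" "invertible S" and N: "pos_def N"
  shows "pos_def (S ** N ** S)"
proof -
  have "S *v x \<noteq> 0" if "x \<noteq> 0" for x
    using inj_matrix_vector_mult[OF S(2)] that by (metis injD matrix_vector_mult_0_right)
  then show ?thesis
    using N unfolding pos_def_def inner_congruence[OF S(1)] by (simp add: sym_congruence[OF S(1)])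
qed

lemma pos_def_mat_1: "pos_def (mat 1)"
  by (simp add: pos_def_def sym_mat_def)

text \<open>This is the argument of Li and Mathias: after \<open>N\<close> is increased to \<open>M = max N \<nu>\<close> with \<open>\<nu>\<close> the
  \<open>k\<close>-th eigenvalue of \<open>N\<close>, all the ratios \<open>eig i (S M S) / (\<nu> * eig i (S S))\<close> are at least 1,
  so the product over \<open>I\<close> is at most the product over all indices, which is a determinant.\<close>
theorem sum_ln_eig_congruence_le:
  fixes S N :: "real^'n^'n"
  assumes S: "sym_mat S" "invertible S" and N: "pos_def N" and I: "I \<subseteq> {1..CARD('n)}"
  shows "(\<Sum>i\<in>I. ln (eig i (S ** N ** S)) - ln (eig i (S ** S))) \<le> (\<Sum>j = 1..card I. ln (eig j N))"
proof (cases "I = {}")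
  case False
  define k where "k = card I"
  have "finite I" using I finite_subset by blast
  then have k: "k \<in> {1..CARD('n)}"
    using False card_mono[OF _ I] by (auto simp: k_def Suc_le_eq card_gt_0_iff)
  define \<nu> where "\<nu> = eig k N"
  have \<nu>: "\<nu> > 0" using eig_pos[OF N k] by (simp add: \<nu>_def)
  obtain U d where U: "orthogonal_matrix U" and Nd: "N = spec_mat U d"
    using sym_mat_spectral N pos_def_def by metis
  have d: "d j > 0" for j using N pos_def_spec_mat_iff[OF U] Nd by simp
  define M where "M = spec_mat U (\<lambda>j. max (d j) \<nu>)"
  have M: "pos_def M" unfolding M_def using \<nu> by (simp add: pos_def_spec_mat_iff[OF U] less_max_iff_disj)
  have NM: "x \<bullet> (N *v x) \<le> x \<bullet> (M *v x)" for x
    unfolding Nd M_def inner_spec_mat by (intro sum_mono mult_right_mono) auto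
  have \<nu>M: "\<nu> * (x \<bullet> x) \<le> x \<bullet> (M *v x)" for x
    unfolding M_def inner_spec_mat inner_orthogonal_columns[OF U, of x] sum_distrib_left
    by (intro sum_mono mult_right_mono) auto
  have SS: "pos_def (S ** S)" using pos_def_congruence[OF S pos_def_mat_1] by simp
  note SNS = pos_def_congruence[OF S N] and SMS = pos_def_congruence[OF S M]
  define r where "r i = ln (eig i (S ** M ** S)) - ln (eig i (S ** S)) - ln \<nu>" for i
  have r_ge: "ln (eig i (S ** N ** S)) - ln (eig i (S ** S)) \<le> r i + ln \<nu>"
    if i: "i \<in> {1..CARD('n)}" for i
  proof -
    have "eig i (S ** N ** S) \<le> eig i (S ** M ** S)"
      using SNS SMS NM i by (intro eig_mono) (auto simp: pos_def_def inner_congruence[OF S(1)])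
    then show ?thesis using eig_pos[OF SNS i] by (simp add: r_def)
  qed
  have r_nonneg: "r i \<ge> 0" if i: "i \<in> {1..CARD('n)}" for i
  proof -
    have "x \<bullet> ((\<nu> *\<^sub>R (S ** S)) *v x) = \<nu> * ((S *v x) \<bullet> (S *v x))" for x
      using inner_congruence[OF S(1), of x "mat 1"]
      by (simp add: scaleR_matrix_vector_assoc[symmetric])
    then have "eig i (\<nu> *\<^sub>R (S ** S)) \<le> eig i (S ** M ** S)"
      using SS SMS \<nu>M i
      by (intro eig_mono) (auto simp: pos_def_def inner_congruence[OF S(1)] sym_mat_def transpose_scalar)
    then have "\<nu> * eig i (S ** S) \<le> eig i (S ** M ** S)"
      using SS \<nu> i by (simp add: eig_scaleR pos_def_def)
    moreover have "\<nu> * eig i (S ** S) > 0" using eig_pos[OF SS i] \<nu> by simp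
    ultimately have "ln (\<nu> * eig i (S ** S)) \<le> ln (eig i (S ** M ** S))" by simp
    then show ?thesis using eig_pos[OF SS i] \<nu> by (simp add: r_def ln_mult)
  qed
  have "(\<Sum>i\<in>I. ln (eig i (S ** N ** S)) - ln (eig i (S ** S))) \<le> (\<Sum>i\<in>I. r i + ln \<nu>)"
    using r_ge I by (intro sum_mono) auto
  also have "\<dots> = (\<Sum>i\<in>I. r i) + k * ln \<nu>"
    by (simp add: sum.distrib k_def)
  also have "(\<Sum>i\<in>I. r i) \<le> (\<Sum>i = 1..CARD('n). r i)"
    using I r_nonneg by (intro sum_mono2) auto
  also have "(\<Sum>i = 1..CARD('n). r i) = ln (det (S ** M ** S)) - ln (det (S ** S)) - CARD('n) * ln \<nu>"
    by (simp add: r_def sum_subtractf ln_det_pos_def SS SMS)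
  \<comment> \<open>Multiplicativity of the determinant makes the contribution of \<open>S\<close>
    cancel; only the spectrum of \<open>M\<close> remains.\<close>
  also have "ln (det (S ** M ** S)) = ln (det M) + ln (det (S ** S))"
    using ln_mult_pos[OF det_pos_def[OF M] det_pos_def[OF SS]] by (simp add: det_mul mult_ac)
  also have "ln (det M) = (\<Sum>j\<in>UNIV. ln (max (d j) \<nu>))"
    unfolding M_def det_spec_mat[OF U] using \<nu> d by (subst ln_prod) (auto simp: max_def)
  also have "\<dots> = (\<Sum>i = 1..CARD('n). ln (max (eig i N) \<nu>))"
    unfolding Nd by (rule sum_eig_spec_mat[OF U, symmetric])
  also have "\<dots> + ln (det (S ** S)) - ln (det (S ** S)) - CARD('n) * ln \<nu> + k * ln \<nu>
      = (\<Sum>i = 1..CARD('n). ln (max (eig i N) \<nu>) - ln \<nu>) + k * ln \<nu>"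
    by (simp add: sum_subtractf)
  \<comment> \<open>Beyond \<open>k\<close> the eigenvalues of \<open>N\<close> are at most
    \<open>\<nu>\<close> and the terms vanish; up to \<open>k\<close> the maximum is the eigenvalue
    itself. The \<open>k\<close> copies of \<open>- ln \<nu>\<close> left over cancel against
    \<open>k * ln \<nu>\<close>.\<close>
  also have "(\<Sum>i = 1..CARD('n). ln (max (eig i N) \<nu>) - ln \<nu>) = (\<Sum>i = 1..k. ln (eig i N) - ln \<nu>)"
  proof (rule sum.mono_neutral_cong_right)
    have "eig i N \<le> \<nu>" if "i \<in> {1..CARD('n)} - {1..k}" for i
      using that N k unfolding \<nu>_def by (intro eig_antimono) (auto simp: pos_def_def)
    then show "\<forall>i\<in>{1..CARD('n)} - {1..k}. ln (max (eig i N) \<nu>) - ln \<nu> = 0"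
      by (auto simp: max_absorb2)
    show "ln (max (eig i N) \<nu>) - ln \<nu> = ln (eig i N) - ln \<nu>" if "i \<in> {1..k}" for i
    proof -
      have "\<nu> \<le> eig i N"
        using that N k unfolding \<nu>_def by (intro eig_antimono) (auto simp: pos_def_def)
      then show ?thesis by (simp add: max_absorb1)
    qed
  qed (use k in auto)
  also have "\<dots> + k * ln \<nu> = (\<Sum>i = 1..k. ln (eig i N))"
    by (simp add: sum_subtractf)
  finally show ?thesis by (simp add: k_def)
qed simp

section \<open>Majorization\<close>

text \<open>Abel summation as an induction: passing from \<open>m k\<close> to the smaller
  \<open>m (Suc k)\<close> can only lower the product with a nonnegative partial sum.\<close>

lemma sum_mult_antimono_ge:
  fixes m \<delta> :: "nat \<Rightarrow> real"
  assumes m: "antimono_on {1..n} m" and \<delta>: "\<And>k. k \<le> n \<Longrightarrow> 0 \<le> (\<Sum>i = 1..k. \<delta> i)"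
    and k: "1 \<le> k" "k \<le> n"
  shows "m k * (\<Sum>i = 1..k. \<delta> i) \<le> (\<Sum>i = 1..k. m i * \<delta> i)"
  using k
proof (induction k rule: nat_induct_at_least)
  case (Suc k)
  have "m (Suc k) * (\<Sum>i = 1..k. \<delta> i) \<le> m k * (\<Sum>i = 1..k. \<delta> i)"
    using monotone_onD[OF m, of k "Suc k"] \<delta>[of k] Suc by (intro mult_right_mono) auto
  also have "\<dots> \<le> (\<Sum>i = 1..k. m i * \<delta> i)"
    using Suc by simp
  finally show ?case by (simp add: distrib_left)
qed simp

text \<open>Convexity of \<open>f\<close> is expressed by a subgradient \<open>m\<close>.\<close>
lemma karamata:
  fixes x y :: "nat \<Rightarrow> real" and f m :: "real \<Rightarrow> real"
  assumes f: "\<And>u v. f u + m u * (v - u) \<le> f v"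
    and x: "antimono_on {1..n} x"
    and le: "\<And>k. k \<le> n \<Longrightarrow> (\<Sum>i = 1..k. x i) \<le> (\<Sum>i = 1..k. y i)"
    and eq: "(\<Sum>i = 1..n. x i) = (\<Sum>i = 1..n. y i)"
  shows "(\<Sum>i = 1..n. f (x i)) \<le> (\<Sum>i = 1..n. f (y i))"
proof (cases "n = 0")
  case False
  \<comment> \<open>Adding the subgradient inequalities at \<open>u\<close> and at \<open>v\<close>
    gives \<open>(m v - m u) * (v - u) \<ge> 0\<close>.\<close>
  have mono: "m u \<le> m v" if "u \<le> v" for u v
  proof (cases "u = v")
    case False
    have "(m v - m u) * (v - u) \<ge> 0"
      using f[of u v] f[of v u] by (simp add: algebra_simps)
    with False that show ?thesis by (simp add: zero_le_mult_iff)
  qed simp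
  \<comment> \<open>The left-hand side is zero by \<open>eq\<close>, so the weighted sum on the
    right is nonnegative.\<close>
  have "m (x n) * (\<Sum>i = 1..n. y i - x i) \<le> (\<Sum>i = 1..n. m (x i) * (y i - x i))"
    using False le x mono
    by (intro sum_mult_antimono_ge[of n "\<lambda>i. m (x i)"]) (auto simp: monotone_on_def sum_subtractf)
  moreover have "(\<Sum>i = 1..n. m (x i) * (y i - x i)) \<le> (\<Sum>i = 1..n. f (y i) - f (x i))"
  proof (intro sum_mono)
    show "m (x i) * (y i - x i) \<le> f (y i) - f (x i)" for i
      using f[of "x i" "y i"] by simp
  qed
  ultimately show ?thesis using eq by (simp add: sum_subtractf)
qed simp

text \<open>A difference of two descending vectors may fail to be monotone. After sorting
  \<open>x\<close> by \<open>e\<close>, each initial segment corresponds to an index set of the same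
  size, to which \<open>le\<close> applies.\<close>

lemma karamata_subsets:
  fixes x y :: "nat \<Rightarrow> real" and f m :: "real \<Rightarrow> real"
  assumes f: "\<And>u v. f u + m u * (v - u) \<le> f v"
    and le: "\<And>I. I \<subseteq> {1..n} \<Longrightarrow> (\<Sum>i\<in>I. x i) \<le> (\<Sum>i = 1..card I. y i)"
    and eq: "(\<Sum>i = 1..n. x i) = (\<Sum>i = 1..n. y i)"
  shows "(\<Sum>i = 1..n. f (x i)) \<le> (\<Sum>i = 1..n. f (y i))"
proof -
  obtain e where e: "bij_betw e {1..n} {1..n}" "antimono_on {1..n} (\<lambda>i. x (e i))"
    using antimono_enumeration[of "{1..n}" x] unfolding card_atLeastAtMost diff_Suc_1 by blast
  have sums: "(\<Sum>i = 1..k. x (e i)) \<le> (\<Sum>i = 1..k. y i)" if "k \<le> n" for k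
  proof -
    have inj: "inj_on e {1..k}" and sub: "e ` {1..k} \<subseteq> {1..n}"
      using e(1) that by (auto simp: bij_betw_def intro: inj_on_subset)
    show ?thesis
      using le[OF sub] unfolding sum.reindex[OF inj] card_image[OF inj] by simp
  qed
  have reindex: "(\<Sum>i = 1..n. g (x (e i))) = (\<Sum>i = 1..n. g (x i))" for g :: "real \<Rightarrow> real"
    by (rule sum.reindex_bij_betw[OF e(1)])
  show ?thesis
    using karamata[of f m, OF f e(2) sums] eq unfolding reindex[of f] reindex[of "\<lambda>u. u"] by blast
qed

text \<open>Since \<open>sgn u * (v - u) \<le> \<bar>v\<bar> - \<bar>u\<bar>\<close>, the claim
  reduces to the tangent inequality for the power function on nonnegative reals. At
  \<open>u = 0\<close> the slope is 0 because \<open>sgn 0 = 0\<close>.\<close>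

lemma abs_powr_subgradient:
  fixes q :: real
  assumes "q \<ge> 1"
  shows "\<bar>u\<bar> powr q + q * sgn u * \<bar>u\<bar> powr (q - 1) * (v - u) \<le> \<bar>v\<bar> powr q"
proof (cases "u = 0")
  case False
  define s t where "s = \<bar>u\<bar>" and "t = \<bar>v\<bar>"
  have s: "s > 0" and t: "t \<ge> 0" using False by (auto simp: s_def t_def)
  have "sgn u * (v - u) \<le> t - s"
    by (auto simp: s_def t_def sgn_if)
  then have "q * s powr (q - 1) * (sgn u * (v - u)) \<le> q * s powr (q - 1) * (t - s)"
    using assms by (intro mult_left_mono) auto
  moreover have "s powr q + q * s powr (q - 1) * (t - s) \<le> t powr q"
  \<comment> \<open>The convexity fact concerns the open half-line, so the endpoint is computed
    directly.\<close>
  proof (cases "t = 0")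
    case True
    have "s powr (q - 1) * s = s powr q"
      using s by (simp add: powr_diff)
    then have "s powr q + q * s powr (q - 1) * (t - s) = (1 - q) * s powr q"
      using True by (simp add: algebra_simps)
    also have "\<dots> \<le> 0" using assms by (simp add: mult_nonpos_nonneg)
    finally show ?thesis using True by simp
  next
    case False
    have "t powr q - s powr q \<ge> (q * s powr (q - 1)) * (t - s)"
    proof (rule convex_on_imp_above_tangent[OF powr_convex[OF assms]])
      show "((\<lambda>x. x powr q) has_field_derivative q * s powr (q - 1)) (at s within {0<..})"
        by (rule has_field_derivative_at_within[OF has_real_derivative_powr[OF s]])
    qed (use s t False in \<open>auto simp: interior_open\<close>)
    then show ?thesis by simp
  qed
  ultimately show ?thesis by (simp add: s_def t_def mult_ac)
qed simp

section \<open>Matrix functions and the distance\<close>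

lemma mat_power_spec_mat:
  assumes "orthogonal_matrix U"
  shows "(((**) (spec_mat U d)) ^^ k) (mat 1) = spec_mat U (\<lambda>j. d j ^ k)"
  by (induction k) (simp_all add: spec_mat_const_1 spec_mat_mult assms)

lemma mat_exp_spec_mat:
  assumes "orthogonal_matrix U"
  shows "mat_exp (spec_mat U d) = spec_mat U (\<lambda>j. exp (d j))"
proof -
  \<comment> \<open>\<open>P j\<close> is the outer product of \<open>column j U\<close> with
    itself. A diagonalized matrix is a finite combination of these, so the scalar exponential series
    can be summed coefficientwise.\<close>
  define P where "P j = (\<chi> i k. U $ i $ j * U $ k $ j)" for j
  have P: "spec_mat U e = (\<Sum>j\<in>UNIV. e j *\<^sub>R P j)" for e
    by (simp add: vec_eq_iff spec_mat_nth P_def)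
  have "(\<lambda>k. (d j ^ k /\<^sub>R fact k) *\<^sub>R P j) sums (exp (d j) *\<^sub>R P j)" for j
    by (intro bounded_linear.sums[OF bounded_linear_scaleR_left] exp_converges)
  then have "(\<lambda>k. \<Sum>j\<in>UNIV. (d j ^ k /\<^sub>R fact k) *\<^sub>R P j) sums spec_mat U (\<lambda>j. exp (d j))"
    unfolding P by (intro sums_sum)
  moreover have "(\<Sum>j\<in>UNIV. (d j ^ k /\<^sub>R fact k) *\<^sub>R P j) = (1 / fact k) *\<^sub>R spec_mat U (\<lambda>j. d j ^ k)" for k
    by (simp add: P scaleR_sum_right divide_inverse)
  ultimately show ?thesis
    unfolding mat_exp_def mat_power_spec_mat[OF assms] by (simp add: sums_iff)
qed

text \<open>Uniqueness is the delicate half: another logarithm \<open>X\<close> may be diagonalized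
  in a different basis \<open>V\<close>, and \<open>spec_mat_fun_cong\<close> with \<open>ln\<close>
  shows that both bases give the same matrix.\<close>

lemma mat_log_spec_mat:
  assumes U: "orthogonal_matrix U" and d: "\<And>j. d j > 0"
  shows "mat_log (spec_mat U d) = spec_mat U (\<lambda>j. ln (d j))"
  unfolding mat_log_def
proof (rule the_equality)
  show "sym_mat (spec_mat U (\<lambda>j. ln (d j))) \<and> mat_exp (spec_mat U (\<lambda>j. ln (d j))) = spec_mat U d"
    using d by (simp add: mat_exp_spec_mat[OF U])
next
  fix X assume X: "sym_mat X \<and> mat_exp X = spec_mat U d"
  then obtain V x where V: "orthogonal_matrix V" "X = spec_mat V x"
    using sym_mat_spectral by blast
  with X have "spec_mat V (\<lambda>j. exp (x j)) = spec_mat U d"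
    by (simp add: mat_exp_spec_mat)
  from spec_mat_fun_cong[OF V(1) U this, of ln]
  show "X = spec_mat U (\<lambda>j. ln (d j))" by (simp add: V(2))
qed

lemma mat_sqrt_spec_mat:
  assumes U: "orthogonal_matrix U" and d: "\<And>j. d j > 0"
  shows "mat_sqrt (spec_mat U d) = spec_mat U (\<lambda>j. sqrt (d j))"
  unfolding mat_sqrt_def
proof (rule the_equality)
  show "pos_def (spec_mat U (\<lambda>j. sqrt (d j)))
      \<and> spec_mat U (\<lambda>j. sqrt (d j)) ** spec_mat U (\<lambda>j. sqrt (d j)) = spec_mat U d"
    using d by (simp add: pos_def_spec_mat_iff[OF U] spec_mat_mult[OF U] less_imp_le)
next
  fix X assume X: "pos_def X \<and> X ** X = spec_mat U d"
  then obtain V x where V: "orthogonal_matrix V" "X = spec_mat V x"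
    using sym_mat_spectral pos_def_def by metis
  \<comment> \<open>Positivity selects the root: \<open>sqrt (x j * x j) = x j\<close>, so applying
    \<open>sqrt\<close> across the two bases returns \<open>X\<close>.\<close>
  have x: "x j > 0" for j using X V pos_def_spec_mat_iff by blast
  have "spec_mat V (\<lambda>j. x j * x j) = spec_mat U d"
    using X by (simp add: V spec_mat_mult)
  from spec_mat_fun_cong[OF V(1) U this, of sqrt]
  show "X = spec_mat U (\<lambda>j. sqrt (d j))" using x by (simp add: V(2) less_imp_le)
qed

lemma matrix_inv_eqI:
  fixes A B :: "real^'n^'n"
  assumes "A ** B = mat 1"
  shows "matrix_inv A = B"
proof -
  have BA: "B ** A = mat 1" using assms by (simp add: matrix_left_right_inverse)
  have "A ** matrix_inv A = mat 1"
    unfolding matrix_inv_def using someI[of "\<lambda>A'. A ** A' = mat 1 \<and> A' ** A = mat 1" B] assms BA by simp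
  then have "B ** A ** matrix_inv A = B" by (simp add: matrix_mul_assoc[symmetric])
  then show ?thesis by (simp add: BA)
qed

text \<open>For symmetric \<open>Z\<close> the product \<open>transpose Z ** Z\<close> is the square
  of \<open>Z\<close>, so its singular values are the absolute values of its eigenvalues; the outer
  power cancels the exponent \<open>1 / q\<close>.\<close>

lemma schatten_norm_powr_spec_mat:
  fixes U :: "real^'n^'n"
  assumes U: "orthogonal_matrix U" and q: "q \<noteq> 0"
  shows "schatten_norm q (spec_mat U d) powr q = (\<Sum>j\<in>UNIV. \<bar>d j\<bar> powr q)"
proof -
  have "(\<Sum>i = 1..CARD('n). sing_val i (spec_mat U d) powr q)
      = (\<Sum>i = 1..CARD('n). (\<lambda>t. sqrt t powr q) (eig i (spec_mat U (\<lambda>j. d j * d j))))"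
    by (simp add: sing_val_def spec_mat_mult[OF U])
  also have "\<dots> = (\<Sum>j\<in>UNIV. \<bar>d j\<bar> powr q)"
    unfolding sum_eig_spec_mat[OF U, of "\<lambda>t. sqrt t powr q"] by simp
  finally show ?thesis
    using q by (simp add: schatten_norm_def powr_powr sum_nonneg)
qed

theorem corollary2:
  fixes A B :: "real^'n^'n" and q :: real
  assumes "pos_def A" and "pos_def B" and "q \<ge> 1"
  shows "(\<Sum>i = 1..CARD('n). \<bar>ln (eig i A) - ln (eig i B)\<bar> powr q) \<le> (spd_dist q A B) powr q
       \<and> (spd_dist q A B) powr q
           \<le> (\<Sum>i = 1..CARD('n). \<bar>ln (eig i A) - ln (eig (CARD('n) - i + 1) B)\<bar> powr q)"
proof -
  let ?n = "CARD('n)"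
  obtain V b where V: "orthogonal_matrix V" and Bb: "B = spec_mat V b"
    using sym_mat_spectral assms(2) pos_def_def by metis
  have b: "b j > 0" for j using assms(2) pos_def_spec_mat_iff[OF V] Bb by simp
  then have b': "b j \<noteq> 0" "sqrt (b j) * sqrt (b j) = b j" for j
    by (simp_all add: less_imp_neq[symmetric] less_imp_le)
  \<comment> \<open>\<open>S\<close> and \<open>R\<close> are the square root of \<open>B\<close>
    and its inverse, written in an eigenbasis of \<open>B\<close>.\<close>
  define S where "S = spec_mat V (\<lambda>j. sqrt (b j))"
  define R where "R = spec_mat V (\<lambda>j. inverse (sqrt (b j)))"
  have SR: "S ** R = mat 1" and RS: "R ** S = mat 1" and SS: "S ** S = B"
    unfolding S_def R_def Bb by (simp_all add: spec_mat_mult[OF V] spec_mat_const_1[OF V] b' del: real_sqrt_mult_self)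
  have RR: "R ** R = spec_mat V (\<lambda>j. inverse (b j))"
    unfolding R_def spec_mat_mult[OF V] inverse_mult_distrib[symmetric] b'(2) ..
  have S: "sym_mat S" "invertible S" and R: "sym_mat R" "invertible R"
    using SR RS by (auto simp: S_def R_def invertible_def)
  define C where "C = R ** A ** R"
  have C: "pos_def C" unfolding C_def by (rule pos_def_congruence[OF R assms(1)])
  have "S ** C ** S = (S ** R) ** A ** (R ** S)" by (simp add: C_def matrix_mul_assoc)
  then have SCS: "S ** C ** S = A" by (simp add: SR RS)
  obtain W c where W: "orthogonal_matrix W" and Cc: "C = spec_mat W c"
    using sym_mat_spectral C pos_def_def by metis
  have c: "c j > 0" for j using C pos_def_spec_mat_iff[OF W] Cc by simp
  define x y where "x i = ln (eig i A)" and "y i = ln (eig i B)" for i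
  define z where "z i = ln (eig i C)" for i
  have "matrix_inv (mat_sqrt B) = R"
    using matrix_inv_eqI[OF SR] mat_sqrt_spec_mat[OF V b] by (simp add: Bb S_def)
  moreover have "mat_log C = spec_mat W (\<lambda>j. ln (c j))"
    unfolding Cc by (rule mat_log_spec_mat[OF W c])
  ultimately have "spd_dist q A B = schatten_norm q (spec_mat W (\<lambda>j. ln (c j)))"
    by (simp add: spd_dist_def Let_def C_def)
  also have "\<dots> powr q = (\<Sum>j\<in>UNIV. \<bar>ln (c j)\<bar> powr q)"
    using assms(3) by (intro schatten_norm_powr_spec_mat W) auto
  also have "\<dots> = (\<Sum>i = 1..?n. \<bar>z i\<bar> powr q)"
    unfolding z_def Cc by (rule sum_eig_spec_mat[OF W, symmetric])
  finally have dist: "spd_dist q A B powr q = (\<Sum>i = 1..?n. \<bar>z i\<bar> powr q)" .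

  \<comment> \<open>Determinants supply the equality of total sums that both majorizations
    require.\<close>
  have "ln (det A) = ln (det C) + ln (det B)"
    using ln_mult_pos[OF det_pos_def[OF C] det_pos_def[OF assms(2)]]
    unfolding SCS[symmetric] SS[symmetric] by (simp add: det_mul mult_ac)
  then have tot: "(\<Sum>i = 1..?n. x i) = (\<Sum>i = 1..?n. z i) + (\<Sum>i = 1..?n. y i)"
    unfolding x_def y_def z_def by (simp add: ln_det_pos_def assms C)

  \<comment> \<open>Congruence of \<open>C\<close> by \<open>S\<close>, with
    \<open>S ** C ** S = A\<close> and \<open>S ** S = B\<close>. All index sets are needed because
    \<open>x i - y i\<close> is not ordered.\<close>
  have "(\<Sum>i\<in>I. x i - y i) \<le> (\<Sum>i = 1..card I. z i)" if "I \<subseteq> {1..?n}" for I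
    using sum_ln_eig_congruence_le[OF S C that] unfolding SCS SS x_def y_def z_def .
  from karamata_subsets[OF abs_powr_subgradient[OF assms(3)] this] tot
  have lower: "(\<Sum>i = 1..?n. \<bar>x i - y i\<bar> powr q) \<le> (\<Sum>i = 1..?n. \<bar>z i\<bar> powr q)"
    by (simp add: sum_subtractf)

  \<comment> \<open>\<open>R ** R\<close> is the inverse of \<open>B\<close>, whose spectrum runs in
    reverse; this produces the index \<open>?n - i + 1\<close>.\<close>
  have RR_eig: "ln (eig i (R ** R)) = - y (?n - i + 1)" if "i \<in> {1..?n}" for i
    using eig_spec_mat_inverse[OF V b that] unfolding RR y_def Bb by (simp add: ln_inverse)
  \<comment> \<open>Congruence of \<open>A\<close> by \<open>R\<close>. Here \<open>z\<close> is
    already descending, so initial segments suffice, and the \<open>y\<close> terms are moved to the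
    right-hand side.\<close>
  have partial: "(\<Sum>i = 1..k. z i) \<le> (\<Sum>i = 1..k. x i - y (?n - i + 1))" if "k \<le> ?n" for k
  proof -
    have "(\<Sum>i = 1..k. z i - - y (?n - i + 1)) = (\<Sum>i = 1..k. ln (eig i (R ** A ** R)) - ln (eig i (R ** R)))"
      using that by (intro sum.cong refl) (simp add: RR_eig z_def C_def)
    also have "\<dots> \<le> (\<Sum>i = 1..k. x i)"
      using sum_ln_eig_congruence_le[OF R assms(1), of "{1..k}"] that by (simp add: x_def)
    finally show ?thesis by (simp add: sum.distrib sum_subtractf)
  qed
  have anti: "antimono_on {1..?n} z"
    using C eig_antimono[of C] eig_pos[OF C]
    by (auto simp: monotone_on_def z_def pos_def_def)
  have "(\<Sum>i = 1..?n. y (?n - i + 1)) = (\<Sum>i = 1..?n. y i)"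
    by (rule sum.reindex_bij_witness[where i = "\<lambda>i. ?n - i + 1" and j = "\<lambda>i. ?n - i + 1"]) auto
  then have "(\<Sum>i = 1..?n. z i) = (\<Sum>i = 1..?n. x i - y (?n - i + 1))"
    using tot by (simp add: sum_subtractf)
  from karamata[OF abs_powr_subgradient[OF assms(3)] anti partial this]
  have upper: "(\<Sum>i = 1..?n. \<bar>z i\<bar> powr q) \<le> (\<Sum>i = 1..?n. \<bar>x i - y (?n - i + 1)\<bar> powr q)" .

  show ?thesis
    using lower upper unfolding dist x_def y_def by blast
qed

end
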